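(* Let $\mathcal A_1,\dots,\mathcal A_k$ be (integral, homogeneous) point configurations in $\mathbb R^E$ and let $\mathcal A=\sum_{i=1}^k\mathcal A_i$ be their Minkowski sum. Assume that for each $i$, if $\dim\operatorname{Conv}(\mathcal A_i)=1$ then $|\mathcal A_i|=2$. Suppose that a weight $w:\mathcal A\to\mathbb R$ induces a coherent subdivision $\Delta_w$ that is mixed. Then there exist weights $w_1,\dots,w_k$ on $\mathcal A_1,\dots,\mathcal A_k$ such that $\Delta_{\sum_{i=1}^k w_i}=\Delta_w$.
   Context: A point configuration $(\mathcal A,\mathbf a)$ in $\mathbb R^E$ is a finite index set $\mathcal A$ with a map $i\mapsto\mathbf a_i\in\mathbb R^E$ (points may repeat). Standing assumptions: all $\mathbf a_i\in\mathbb Z^E$, and there is $d$ with $\sum_{e\in E}(\mathbf a_i)_e=d$ for all $i$. $\operatorname{Conv}(\mathcal A)=\operatorname{Conv}(\mathbf a_i:i\in\mathcal A)$. A subset $\mathcal F\subseteq\mathcal A$ (with restricted map) is a subconfiguration; for $u\in\mathbb R^E$, $\mathcal F^u:=\{i\in\mathcal F:\langle u,\mathbf a_i\rangle=\min_{j\in\mathcal F}\langle u,\mathbf a_j\rangle\}$, and such sets are the faces of $\mathcal F$. A subdivision of $\mathcal A$ is a collection $\Delta$ of subconfigurations, closed under taking faces, such that $\{\operatorname{Conv}(\mathcal F)\}_{\mathcal F\in\Delta}$ is a polyhedral subdivision of $\operatorname{Conv}(\mathcal A)$ (their union is $\operatorname{Conv}(\mathcal A)$ and any two distinct ones meet in a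 proper face of each). A weight is a function $w:\mathcal A\to\mathbb R$; the coherent subdivision $\Delta_w$ consists of the sets $\Delta_w^u:=\{i\in\mathcal A:\langle u,\mathbf a_i\rangle+w(i)=\min_{j\in\mathcal A}(\langle u,\mathbf a_j\rangle+w(j))\}$ for $u\in\mathbb R^E$ (the lower faces of the lifted configuration $i\mapsto(\mathbf a_i,w(i))$). The Minkowski sum $\sum_i\mathcal A_i$ has index set $\mathcal A_1\times\cdots\times\mathcal A_k$ and map $(j_1,\dots,j_k)\mapsto\sum_i\mathbf a_{j_i}$; the Minkowski sum of weights $w_i$ on $\mathcal A_i$ is $(j_1,\dots,j_k)\mapsto\sum_iw_i(j_i)$. A subdivision $\Delta$ of $\sum_i\mathcal A_i$ is mixed if there are subdivisions $\Delta_i$ of $\mathcal A_i$ such that every face of $\Delta$ is of the form $\mathcal F_1\times\cdots\times\mathcal F_k$ (the Minkowski sum) with $\mathcal F_i\in\Delta_i$. *)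

theory Defs
  imports "HOL-Analysis.Analysis" "HOL-Library.FuncSet"
begin

text \<open>A point configuration is given by an index set \<open>A\<close> and a map \<open>a\<close> into \<open>\<real>\<^sup>E\<close>; only the values of
  \<open>a\<close> (and of a weight \<open>w\<close>) on \<open>A\<close> matter.\<close>

definition point_configuration :: "('i \<Rightarrow> real ^ 'e::finite) \<Rightarrow> 'i set \<Rightarrow> bool" where
  "point_configuration a A \<longleftrightarrow>
     finite A \<and>
     (\<forall>i\<in>A. \<forall>e. a i $ e \<in> \<int>) \<and>
     (\<exists>d. \<forall>i\<in>A. (\<Sum>e\<in>UNIV. a i $ e) = d)"

definition Conv :: "('i \<Rightarrow> real ^ 'e::finite) \<Rightarrow> 'i set \<Rightarrow> (real ^ 'e) set" where
  "Conv a A = convex hull (a ` A)"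

definition config_face :: "('i \<Rightarrow> real ^ 'e::finite) \<Rightarrow> 'i set \<Rightarrow> real ^ 'e \<Rightarrow> 'i set" where
  "config_face a F u = {i \<in> F. u \<bullet> a i = Min ((\<lambda>j. u \<bullet> a j) ` F)}"

text \<open>The cells are closed under faces, so a cell and a face of it meet in the whole of the smaller
  one: the intersection of two distinct cells can be required to be a proper face of at least one of
  them, not of both. The empty set counts as a face.\<close>

definition subdivision :: "('i \<Rightarrow> real ^ 'e::finite) \<Rightarrow> 'i set \<Rightarrow> 'i set set \<Rightarrow> bool" where
  "subdivision a A \<Delta> \<longleftrightarrow>
     \<Delta> \<subseteq> Pow A \<and>
     (\<forall>F\<in>\<Delta>. \<forall>u. config_face a F u \<in> \<Delta>) \<and>
     (\<Union>F\<in>\<Delta>. Conv a F) = Conv a A \<and>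
     (\<forall>F\<in>\<Delta>. \<forall>G\<in>\<Delta>. F \<noteq> G \<longrightarrow>
        (Conv a F \<inter> Conv a G) face_of Conv a F \<and>
        (Conv a F \<inter> Conv a G) face_of Conv a G \<and>
        (Conv a F \<inter> Conv a G \<noteq> Conv a F \<or> Conv a F \<inter> Conv a G \<noteq> Conv a G))"

definition coherent_cell ::
    "('i \<Rightarrow> real ^ 'e::finite) \<Rightarrow> 'i set \<Rightarrow> ('i \<Rightarrow> real) \<Rightarrow> real ^ 'e \<Rightarrow> 'i set" where
  "coherent_cell a A w u = {i \<in> A. u \<bullet> a i + w i = Min ((\<lambda>j. u \<bullet> a j + w j) ` A)}"

definition coherent_subdivision ::
    "('i \<Rightarrow> real ^ 'e::finite) \<Rightarrow> 'i set \<Rightarrow> ('i \<Rightarrow> real) \<Rightarrow> 'i set set" where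
  "coherent_subdivision a A w = {coherent_cell a A w u | u. True}"

text \<open>Tuples \<open>(j\<^sub>1, \<dots>, j\<^sub>k)\<close> are extensional functions on \<open>{1..k}\<close>. The map \<open>mink_sum\<close> serves both for
  points and for weights.\<close>

definition mink_index :: "nat \<Rightarrow> (nat \<Rightarrow> 'i set) \<Rightarrow> (nat \<Rightarrow> 'i) set" where
  "mink_index k A = (\<Pi>\<^sub>E i\<in>{1..k}. A i)"

definition mink_sum :: "nat \<Rightarrow> (nat \<Rightarrow> 'i \<Rightarrow> 'b::comm_monoid_add) \<Rightarrow> (nat \<Rightarrow> 'i) \<Rightarrow> 'b" where
  "mink_sum k f j = (\<Sum>i=1..k. f i (j i))"

definition mixed_subdivision ::
    "nat \<Rightarrow> (nat \<Rightarrow> 'i \<Rightarrow> real ^ 'e::finite) \<Rightarrow> (nat \<Rightarrow> 'i set) \<Rightarrow> (nat \<Rightarrow> 'i) set set \<Rightarrow> bool" where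
  "mixed_subdivision k a A \<Delta> \<longleftrightarrow>
     subdivision (mink_sum k a) (mink_index k A) \<Delta> \<and>
     (\<exists>D. (\<forall>i\<in>{1..k}. subdivision (a i) (A i) (D i)) \<and>
          (\<forall>F\<in>\<Delta>. \<exists>G. (\<forall>i\<in>{1..k}. G i \<in> D i) \<and> F = mink_index k G))"

end

theory Submission
  imports Defs
begin

text \<open>Since every cell of \<open>\<Delta>\<^sub>w\<close> is a product, the cell at \<open>u\<close> splits as \<open>F\<^sub>1(u) \<times> \<cdots> \<times> F\<^sub>k(u)\<close>, and near
  \<open>u\<close> each \<open>F\<^sub>i\<close> takes as values only subsets of faces of \<open>F\<^sub>i(u)\<close>. Hence \<open>F\<^sub>i\<close> is locally the field of
  minimizers of a concave piecewise linear function. On all of \<open>\<real>\<^sup>E\<close> these local functions, which agree up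
  to constants, glue to a function \<open>g\<^sub>i\<close>. Concavity is local along segments, so \<open>g\<^sub>i\<close> is concave with
  superdifferential \<open>Conv(F\<^sub>i(u))\<close> at \<open>u\<close>. The weight \<open>w\<^sub>i(j)\<close> is \<open>g\<^sub>i(u) - \<langle>u, a\<^sub>j\<rangle>\<close> for any \<open>u\<close> with
  \<open>j \<in> F\<^sub>i(u)\<close>, and large if there is no such \<open>u\<close>. That the minimizers at \<open>u\<close> are exactly \<open>F\<^sub>i(u)\<close> follows
  because a cell of the subdivision \<open>\<Delta>\<^sub>i\<close> contains every index used by \<open>\<Delta>\<^sub>i\<close> whose point lies in its hull.\<close>

section \<open>Local potentials of a field of cells and their gluing\<close>

text \<open>\<open>F\<close> models one factor of the product cells: locally it looks like a field
  of minimizers, but no weight is given in advance. Near \<open>u\<close>, \<open>cell_near\<close>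
  puts \<open>F v\<close> inside the face of \<open>F u\<close> that is minimal in direction
  \<open>v - u\<close>.\<close>

locale cell_field =
  fixes a :: "'i \<Rightarrow> 'v::euclidean_space" and F :: "'v \<Rightarrow> 'i set"
  assumes cell_nonempty: "F u \<noteq> {}"
    and cell_near: "\<forall>\<^sub>F v in nhds u. \<forall>j\<in>F v. j \<in> F u \<and> (\<forall>i\<in>F u. (v - u) \<bullet> a j \<le> (v - u) \<bullet> a i)"
begin

text \<open>By \<open>cell_near\<close> the increment is the minimum of
  \<open>(v - u) \<bullet> a i\<close> over \<open>F u\<close>. Writing it with an index of
  \<open>F v\<close> lets two potentials be compared through one common term.\<close>

definition potential_on :: "'v set \<Rightarrow> ('v \<Rightarrow> real) \<Rightarrow> bool" where
  "potential_on U g \<longleftrightarrow> (\<forall>u\<in>U. \<forall>\<^sub>F v in nhds u. \<forall>j\<in>F v. g v = g u + (v - u) \<bullet> a j)"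

lemma potential_on_subset: "potential_on U g \<Longrightarrow> V \<subseteq> U \<Longrightarrow> potential_on V g"
  unfolding potential_on_def by blast

lemma potential_on_add_const: "potential_on U g \<Longrightarrow> potential_on U (\<lambda>x. g x + c)"
  unfolding potential_on_def by (auto elim: eventually_mono)

lemma potential_on_local:
  assumes "\<And>u. u \<in> U \<Longrightarrow> \<exists>V h. open V \<and> u \<in> V \<and> potential_on V h \<and> (\<forall>x\<in>V. g x = h x)"
  shows "potential_on U g"
  unfolding potential_on_def
proof
  fix u assume "u \<in> U"
  then obtain V h where V: "open V" "u \<in> V" "potential_on V h" "\<forall>x\<in>V. g x = h x"
    using assms by blast
  then have "\<forall>\<^sub>F v in nhds u. \<forall>j\<in>F v. h v = h u + (v - u) \<bullet> a j"
    unfolding potential_on_def by blast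
  moreover have "\<forall>\<^sub>F v in nhds u. v \<in> V"
    using V by (simp add: eventually_nhds_in_open)
  ultimately show "\<forall>\<^sub>F v in nhds u. \<forall>j\<in>F v. g v = g u + (v - u) \<bullet> a j"
    by eventually_elim (use V in auto)
qed

text \<open>Near each point both potentials grow by the same \<open>(v - u) \<bullet> a j\<close>,
  so their difference is locally constant.\<close>

lemma potential_on_unique:
  assumes "connected U" "potential_on U g" "potential_on U h" "x \<in> U" "y \<in> U"
  shows "g x - h x = g y - h y"
proof (rule connected_local_const[where f = "\<lambda>x. g x - h x", OF assms(1,4,5)], rule ballI)
  fix u assume "u \<in> U"
  then have "\<forall>\<^sub>F v in nhds u. \<forall>j\<in>F v. g v = g u + (v - u) \<bullet> a j"
      "\<forall>\<^sub>F v in nhds u. \<forall>j\<in>F v. h v = h u + (v - u) \<bullet> a j"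
    using assms unfolding potential_on_def by blast+
  then have "\<forall>\<^sub>F v in nhds u. g u - h u = g v - h v"
  proof eventually_elim
    case (elim v)
    then show ?case using cell_nonempty[of v] by fastforce
  qed
  then show "\<forall>\<^sub>F v in at u within U. g u - h u = g v - h v"
    by (auto simp: eventually_at_filter elim: eventually_mono)
qed

text \<open>The candidate is \<open>(v - p) \<bullet> a j\<close> with \<open>j\<close> in
  \<open>F v\<close>; every such \<open>j\<close> minimizes over \<open>F p\<close>, so the choice
  is immaterial. For \<open>v\<close> near \<open>u\<close> in the ball, \<open>F v\<close> lies in
  \<open>F u\<close>, so one \<open>j\<close> computes \<open>g\<close> at both points.\<close>

lemma potential_locally: "\<exists>e>0. \<exists>g. potential_on (ball p e) g"
proof -
  obtain e where e: "e > 0" and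
    near: "\<And>v. dist v p < e \<Longrightarrow> \<forall>j\<in>F v. j \<in> F p \<and> (\<forall>i\<in>F p. (v - p) \<bullet> a j \<le> (v - p) \<bullet> a i)"
    using cell_near[of p] unfolding eventually_nhds_metric by blast
  define g where "g v = (v - p) \<bullet> a (SOME j. j \<in> F v)" for v
  have g: "g v = (v - p) \<bullet> a j" if "dist v p < e" "j \<in> F v" for v j
  proof -
    have "(SOME j. j \<in> F v) \<in> F v" using that(2) by (rule someI)
    then show ?thesis unfolding g_def using near[OF that(1)] that(2) by (meson order_antisym)
  qed
  have "potential_on (ball p e) g"
    unfolding potential_on_def
  proof
    fix u assume u: "u \<in> ball p e"
    have "\<forall>\<^sub>F v in nhds u. v \<in> ball p e"
      using open_ball u by (rule eventually_nhds_in_open)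
    then show "\<forall>\<^sub>F v in nhds u. \<forall>j\<in>F v. g v = g u + (v - u) \<bullet> a j"
      using cell_near[of u]
    proof eventually_elim
      case (elim v)
      show ?case
      proof
        fix j assume "j \<in> F v"
        with elim u show "g v = g u + (v - u) \<bullet> a j"
          by (simp add: g[of v j] g[of u j] dist_commute inner_diff_left)
      qed
    qed
  qed
  with e show ?thesis by blast
qed

text \<open>Two overlapping balls with centres in the convex set \<open>U\<close> both contain the midpoint of the centres,
  which lies in \<open>U\<close>; this is why the extensions to the two balls agree.\<close>

lemma potential_extend:
  assumes U: "convex U" and d: "d > 0" and g: "potential_on U g"
    and loc: "\<And>p. p \<in> U \<Longrightarrow> \<exists>h. potential_on (ball p d) h"
  shows "\<exists>h. potential_on (\<Union>p\<in>U. ball p d) h"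
proof -
  have "\<exists>h. potential_on (ball p d) h \<and> (\<forall>x\<in>ball p d \<inter> U. h x = g x)" if p: "p \<in> U" for p
  proof -
    obtain h where h: "potential_on (ball p d) h" using loc[OF p] by blast
    have "h x + (g p - h p) = g x" if "x \<in> ball p d \<inter> U" for x
    proof -
      have "g x - h x = g p - h p"
        using that p d h g U
        by (intro potential_on_unique[of "ball p d \<inter> U"])
           (auto intro: potential_on_subset convex_connected convex_Int)
      then show ?thesis by linarith
    qed
    then show ?thesis using potential_on_add_const[OF h, of "g p - h p"] by blast
  qed
  then obtain h where h: "\<And>p. p \<in> U \<Longrightarrow> potential_on (ball p d) (h p)"
    and hg: "\<And>p x. p \<in> U \<Longrightarrow> x \<in> ball p d \<Longrightarrow> x \<in> U \<Longrightarrow> h p x = g x"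
    by (metis IntI)
  have agree: "h p x = h q x" if pq: "p \<in> U" "q \<in> U" and x: "x \<in> ball p d" "x \<in> ball q d" for p q x
  proof -
    \<comment> \<open>The common radius \<open>d\<close> matters: centres less than
      \<open>2 * d\<close> apart have their midpoint within \<open>d\<close> of both.\<close>
    have "dist p q < 2 * d" using x dist_triangle[of p q x] by (simp add: dist_commute)
    then have m: "midpoint p q \<in> ball p d" "midpoint p q \<in> ball q d"
      by (auto simp: dist_midpoint)
    have mU: "midpoint p q \<in> U"
      using U pq by (metis convex_contains_segment midpoint_in_closed_segment subsetD)
    have "h p x - h q x = h p (midpoint p q) - h q (midpoint p q)"
      using x m h[OF pq(1)] h[OF pq(2)]
      by (intro potential_on_unique[of "ball p d \<inter> ball q d"])
         (auto intro: potential_on_subset convex_connected convex_Int)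
    then show ?thesis using hg[OF pq(1) m(1) mU] hg[OF pq(2) m(2) mU] by simp
  qed
  define s where "s x = (SOME p. p \<in> U \<and> x \<in> ball p d)" for x
  have s: "s x \<in> U \<and> x \<in> ball (s x) d" if "p \<in> U" "x \<in> ball p d" for p x
    unfolding s_def by (rule someI[of _ p]) (use that in auto)
  have "potential_on (\<Union>p\<in>U. ball p d) (\<lambda>x. h (s x) x)"
  proof (rule potential_on_local)
    fix u assume "u \<in> (\<Union>p\<in>U. ball p d)"
    then obtain p where p: "p \<in> U" "u \<in> ball p d" by blast
    have "h (s x) x = h p x" if "x \<in> ball p d" for x
      using s[OF p(1) that] agree p(1) that by blast
    then show "\<exists>V h'. open V \<and> u \<in> V \<and> potential_on V h' \<and> (\<forall>x\<in>V. h (s x) x = h' x)"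
      using p h by blast
  qed
  then show ?thesis by blast
qed

text \<open>With a Lebesgue number \<open>d\<close>, every ball of radius \<open>d\<close> centred
  in \<open>cball 0 R\<close> carries a potential, so a ball around 0 can be enlarged by
  \<open>d\<close> at a time.\<close>

lemma potential_on_ball: "\<exists>g. potential_on (ball 0 R) g"
proof (cases "R \<ge> 0")
  case True
  obtain \<epsilon> where \<epsilon>: "\<And>p. \<epsilon> p > 0" "\<And>p. \<exists>g. potential_on (ball p (\<epsilon> p)) g"
    using potential_locally by metis
  have cover: "cball (0::'v) R \<subseteq> \<Union> (range (\<lambda>p. ball p (\<epsilon> p)))"
    using \<epsilon>(1) centre_in_ball by blast
  obtain d where d: "d > 0" and leb: "\<And>x. x \<in> cball 0 R \<Longrightarrow> \<exists>G\<in>range (\<lambda>p. ball p (\<epsilon> p)). ball x d \<subseteq> G"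
    by (rule Heine_Borel_lemma[OF compact_cball cover]) auto
  have loc: "\<exists>g. potential_on (ball p d) g" if "norm p \<le> R" for p
  proof -
    obtain q where q: "ball p d \<subseteq> ball q (\<epsilon> q)" using leb[of p] \<open>norm p \<le> R\<close> by auto
    obtain g where "potential_on (ball q (\<epsilon> q)) g" using \<epsilon>(2) by blast
    then show ?thesis using potential_on_subset q by blast
  qed
  have "real n * d \<le> R \<Longrightarrow> \<exists>g. potential_on (ball 0 (real (Suc n) * d)) g" for n
  proof (induction n)
    case 0
    then show ?case using loc[of 0] by simp
  next
    case (Suc n)
    have "real n * d \<le> real (Suc n) * d" using d by simp
    then obtain g where g: "potential_on (ball 0 (real (Suc n) * d)) g"
      using Suc.IH Suc.prems by (meson order_trans)
    have "\<exists>h. potential_on (\<Union>p\<in>ball 0 (real (Suc n) * d). ball p d) h"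
      using d g by (rule potential_extend[OF convex_ball]) (use Suc.prems in \<open>auto intro!: loc\<close>)
    moreover have "ball 0 (real (Suc (Suc n)) * d) \<subseteq> (\<Union>p\<in>ball (0::'v) (real (Suc n) * d). ball p d)"
    proof
      fix x :: 'v assume x: "x \<in> ball 0 (real (Suc (Suc n)) * d)"
      define N where "N = real (Suc (Suc n))"
      \<comment> \<open>The point \<open>c *\<^sub>R x\<close> on the segment from 0 to
        \<open>x\<close> serves as centre: \<open>c\<close> divides \<open>N * d\<close> into
        \<open>real (Suc n) * d\<close> and \<open>d\<close>.\<close>
      define c where "c = real (Suc n) / N"
      have c: "0 < c" "c < 1" "c * N = real (Suc n)" "(1 - c) * N = 1"
        unfolding c_def N_def by (auto simp: field_simps)
      have nx: "norm x < N * d" using x by (simp add: N_def)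
      have "c * norm x < c * (N * d)" using nx c(1) by (rule mult_strict_left_mono)
      also have "\<dots> = real (Suc n) * d" by (metis c(3) mult.assoc)
      finally have 1: "norm (c *\<^sub>R x) < real (Suc n) * d" using c(1) by simp
      have "(1 - c) * norm x < (1 - c) * (N * d)" using nx c(2) by (intro mult_strict_left_mono) auto
      also have "\<dots> = d" by (metis c(4) mult.assoc mult_1)
      finally have "(1 - c) * norm x < d" .
      moreover have "dist (c *\<^sub>R x) x = (1 - c) * norm x"
      proof -
        have "c *\<^sub>R x - x = - ((1 - c) *\<^sub>R x)" by (simp add: algebra_simps)
        then show ?thesis using c by (simp add: dist_norm)
      qed
      ultimately show "x \<in> (\<Union>p\<in>ball (0::'v) (real (Suc n) * d). ball p d)"
        using 1 by (intro UN_I[of "c *\<^sub>R x"]) auto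
    qed
    ultimately show ?case using potential_on_subset by blast
  qed
  \<comment> \<open>This is the last \<open>n\<close> with \<open>real n * d \<le> R\<close>; the
    ball reached has radius greater than \<open>R\<close>.\<close>
  moreover define n where "n = nat \<lfloor>R / d\<rfloor>"
  have "real n = of_int \<lfloor>R / d\<rfloor>" unfolding n_def using True d by simp
  then have "real n \<le> R / d" "R / d < real n + 1" by linarith+
  then have "real n * d \<le> R" "R < real (Suc n) * d" using d by (auto simp: field_simps)
  ultimately show ?thesis using potential_on_subset[OF _ subset_ball] by (meson less_imp_le)
next
  case False
  then have "ball (0::'v) R = {}" by simp
  then show ?thesis unfolding potential_on_def by blast
qed

lemma potential_on_UNIV: "\<exists>g. potential_on UNIV g"
proof -
  obtain G where G: "\<And>R. potential_on (ball 0 R) (G R)"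
    using potential_on_ball by metis
  \<comment> \<open>Subtracting the value at 0 makes the potentials of different balls agree; the
    radius \<open>norm x + 1\<close> puts both \<open>x\<close> and 0 inside the ball.\<close>
  define g where "g x = G (norm x + 1) x - G (norm x + 1) 0" for x
  have g: "g x = G R x - G R 0" if "norm x < R" for x R
  proof -
    have pos: "0 < R" "0 < norm x + 1" using that norm_ge_zero[of x] by linarith+
    have "G (norm x + 1) x - G R x = G (norm x + 1) 0 - G R 0"
      using pos that G[of R] G[of "norm x + 1"]
      by (intro potential_on_unique[of "ball 0 (min R (norm x + 1))"])
         (auto intro: potential_on_subset)
    then show ?thesis by (simp add: g_def)
  qed
  have "potential_on UNIV g"
  proof (rule potential_on_local)
    fix u :: 'v
    show "\<exists>V h. open V \<and> u \<in> V \<and> potential_on V h \<and> (\<forall>x\<in>V. g x = h x)"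
      using potential_on_add_const[OF G, of "norm u + 1" "- G (norm u + 1) 0"] g
      by (intro exI[of _ "ball 0 (norm u + 1)"] exI[of _ "\<lambda>x. G (norm u + 1) x + (- G (norm u + 1) 0)"]) auto
  qed
  then show ?thesis by blast
qed

section \<open>Concavity and supergradients of a global potential\<close>

text \<open>Concavity is checked on the segment from \<open>u\<close> to \<open>v\<close>: bisection
  reduces it to short intervals, where \<open>cell_near\<close> applies.\<close>

lemma potential_supergradient:
  assumes g: "potential_on UNIV g" and j: "j \<in> F u"
  shows "g v \<le> g u + (v - u) \<bullet> a j"
proof -
  define h where "h = v - u"
  define p where "p t = u + t *\<^sub>R h" for t :: real
  \<comment> \<open>The inequality alone does not pass to the union of adjacent intervals, so
    \<open>P\<close> also records that slopes do not increase. The guard \<open>s < t\<close> is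
    there because indices of one cell may have different slopes.\<close>
  define P where "P s t \<longleftrightarrow> (\<forall>i\<in>F (p s). g (p t) \<le> g (p s) + (t - s) * (h \<bullet> a i) \<and>
      (s < t \<longrightarrow> (\<forall>l\<in>F (p t). h \<bullet> a l \<le> h \<bullet> a i)))" for s t
  have "P 0 1"
  proof (rule Bolzano[of 0 1 P])
    fix r s t assume rs: "P r s" and st: "P s t" and le: "r \<le> s" "s \<le> t"
    show "P r t"
    proof (cases "r = s \<or> s = t")
      case True
      then show ?thesis using rs st by auto
    next
      case False
      then have lt: "r < s" "s < t" using le by auto
      obtain m where m: "m \<in> F (p s)" using cell_nonempty by blast
      show ?thesis unfolding P_def
      proof (intro ballI conjI impI)
        fix i assume i: "i \<in> F (p r)"
        have 1: "h \<bullet> a m \<le> h \<bullet> a i" using rs i m lt unfolding P_def by blast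
        have "g (p t) \<le> g (p s) + (t - s) * (h \<bullet> a m)" using st m unfolding P_def by blast
        also have "\<dots> \<le> g (p s) + (t - s) * (h \<bullet> a i)" using 1 lt by simp
        also have "g (p s) \<le> g (p r) + (s - r) * (h \<bullet> a i)" using rs i unfolding P_def by blast
        finally show "g (p t) \<le> g (p r) + (t - r) * (h \<bullet> a i)" by (simp add: algebra_simps)
        fix l assume "l \<in> F (p t)"
        then have "h \<bullet> a l \<le> h \<bullet> a m" using st m lt unfolding P_def by blast
        with 1 show "h \<bullet> a l \<le> h \<bullet> a i" by linarith
      qed
    qed
  next
    fix x :: real
    have "\<forall>\<^sub>F v in nhds (p x). \<forall>j\<in>F v. g v = g (p x) + (v - p x) \<bullet> a j"
      using g unfolding potential_on_def by blast
    then have "\<forall>\<^sub>F v in nhds (p x). \<forall>j\<in>F v. g v = g (p x) + (v - p x) \<bullet> a j \<and> j \<in> F (p x) \<and>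
        (\<forall>i\<in>F (p x). (v - p x) \<bullet> a j \<le> (v - p x) \<bullet> a i)"
      using cell_near[of "p x"] by eventually_elim blast
    moreover have "filterlim p (nhds (p x)) (nhds x)"
      unfolding p_def by (intro tendsto_intros filterlim_ident)
    ultimately have "\<forall>\<^sub>F s in nhds x. \<forall>j\<in>F (p s). g (p s) = g (p x) + (p s - p x) \<bullet> a j \<and> j \<in> F (p x) \<and>
        (\<forall>i\<in>F (p x). (p s - p x) \<bullet> a j \<le> (p s - p x) \<bullet> a i)"
      by (rule eventually_compose_filterlim)
    then obtain d where d: "d > 0" and near: "\<And>s j. dist s x < d \<Longrightarrow> j \<in> F (p s) \<Longrightarrow>
        g (p s) = g (p x) + (p s - p x) \<bullet> a j \<and> j \<in> F (p x) \<and>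
        (\<forall>i\<in>F (p x). (p s - p x) \<bullet> a j \<le> (p s - p x) \<bullet> a i)"
      unfolding eventually_nhds_metric by blast
    have pd: "p s - p x = (s - x) *\<^sub>R h" for s unfolding p_def by (simp add: algebra_simps)
    have "P s t" if st: "s \<le> x" "x \<le> t" "t - s < d" for s t
      unfolding P_def
    proof (intro ballI)
      fix i assume i: "i \<in> F (p s)"
      have "dist s x < d" "dist t x < d" using st by (auto simp: dist_real_def)
      note ns = near[OF this(1) i] and nt = near[OF this(2)]
      \<comment> \<open>Both \<open>i\<close> and \<open>l\<close> lie in \<open>F (p x)\<close>. If
        \<open>x < t\<close>, then \<open>l\<close> has the least slope there; otherwise
        \<open>s < x\<close>, and the negative factor \<open>s - x\<close> gives \<open>i\<close>
        the greatest slope.\<close>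
      have l: "h \<bullet> a l \<le> h \<bullet> a i" if lt: "s < t" and l: "l \<in> F (p t)" for l
      proof (cases "x < t")
        case True
        then show ?thesis using nt[OF l] ns unfolding pd by auto
      next
        case False
        then have "s < x" using st lt by linarith
        then show ?thesis using nt[OF l] ns unfolding pd by (auto simp: mult_le_cancel_left)
      qed
      have "g (p t) \<le> g (p s) + (t - s) * (h \<bullet> a i)"
      proof (cases "s < t")
        case True
        obtain m where m: "m \<in> F (p t)" using cell_nonempty by blast
        have "(t - x) * (h \<bullet> a m) \<le> (t - x) * (h \<bullet> a i)"
          using l[OF True m] st by (simp add: mult_left_mono)
        moreover have "g (p s) = g (p x) + (s - x) * (h \<bullet> a i)" "g (p t) = g (p x) + (t - x) * (h \<bullet> a m)"
          using ns nt[OF m] unfolding pd by auto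
        ultimately show ?thesis by (simp add: algebra_simps)
      next
        case False
        then have "s = t" using st by linarith
        then show ?thesis by simp
      qed
      with l show "g (p t) \<le> g (p s) + (t - s) * (h \<bullet> a i) \<and>
          (s < t \<longrightarrow> (\<forall>l\<in>F (p t). h \<bullet> a l \<le> h \<bullet> a i))" by blast
    qed
    with d show "\<exists>d>0. \<forall>s t. s \<le> x \<and> x \<le> t \<and> t - s < d \<longrightarrow> P s t" by blast
  qed simp
  then show ?thesis using j unfolding P_def p_def h_def by simp
qed

text \<open>If a hyperplane with normal \<open>h\<close> separated \<open>y\<close> from the hull, a
  small move from \<open>u\<close> along \<open>h\<close> would raise \<open>g\<close> with a slope
  \<open>h \<bullet> a j\<close> above \<open>h \<bullet> y\<close>, for some \<open>j\<close> in
  \<open>F u\<close>.\<close>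

lemma supergradient_in_hull:
  assumes g: "potential_on UNIV g" and fin: "finite (F u)"
    and y: "\<And>v. g v \<le> g u + (v - u) \<bullet> y"
  shows "y \<in> convex hull (a ` F u)"
proof (rule ccontr)
  assume "y \<notin> convex hull (a ` F u)"
  moreover have "closed (convex hull (a ` F u))"
    using fin by (simp add: compact_convex_hull compact_imp_closed finite_imp_compact)
  ultimately obtain h b where hb: "h \<bullet> y < b" "\<And>x. x \<in> convex hull (a ` F u) \<Longrightarrow> h \<bullet> x > b"
    using separating_hyperplane_closed_point[OF convex_convex_hull] by metis
  have "\<forall>\<^sub>F v in nhds u. \<forall>j\<in>F v. g v = g u + (v - u) \<bullet> a j"
    using g unfolding potential_on_def by blast
  then have "\<forall>\<^sub>F v in nhds u. \<forall>j\<in>F v. g v = g u + (v - u) \<bullet> a j \<and> j \<in> F u"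
    using cell_near[of u] by eventually_elim blast
  moreover have "((\<lambda>t::real. u + t *\<^sub>R h) \<longlongrightarrow> u + 0 *\<^sub>R h) (at_right 0)"
    by (intro tendsto_intros)
  then have "filterlim (\<lambda>t::real. u + t *\<^sub>R h) (nhds u) (at_right 0)" by simp
  ultimately have "\<forall>\<^sub>F t in at_right (0::real). \<forall>j\<in>F (u + t *\<^sub>R h).
      g (u + t *\<^sub>R h) = g u + (u + t *\<^sub>R h - u) \<bullet> a j \<and> j \<in> F u"
    by (rule eventually_compose_filterlim)
  then have "\<forall>\<^sub>F t in at_right (0::real). False"
    using eventually_at_right_less[of "0::real"]
  proof eventually_elim
    case (elim t)
    obtain j where j: "j \<in> F (u + t *\<^sub>R h)" using cell_nonempty by blast
    then have "t * (h \<bullet> a j) \<le> t * (h \<bullet> y)" "j \<in> F u"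
      using elim(1) y[of "u + t *\<^sub>R h"] by auto
    then have "h \<bullet> a j \<le> h \<bullet> y" using elim(2) by simp
    moreover have "b < h \<bullet> a j" using hb(2) \<open>j \<in> F u\<close> by (simp add: hull_inc)
    ultimately show False using hb(1) by linarith
  qed
  then show False by simp
qed

text \<open>The gradients of affine upper bounds of \<open>g\<close> form a convex set that contains
  the points of all cells. The bound \<open>M\<close> later yields a weight for an index in no
  cell.\<close>

lemma potential_bounded_on_hull:
  assumes g: "potential_on UNIV g" and y: "y \<in> convex hull (a ` (\<Union>u. F u))"
  shows "\<exists>M. \<forall>v. g v \<le> v \<bullet> y + M"
proof -
  have "convex hull (a ` (\<Union>u. F u)) \<subseteq> {x. \<exists>M. \<forall>v. g v \<le> v \<bullet> x + M}"
  proof (rule hull_minimal)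
    show "a ` (\<Union>u. F u) \<subseteq> {x. \<exists>M. \<forall>v. g v \<le> v \<bullet> x + M}"
    proof clarify
      fix j u assume "j \<in> F u"
      then have "g v \<le> v \<bullet> a j + (g u - u \<bullet> a j)" for v
        using potential_supergradient[OF g, of j u v] by (simp add: inner_diff_left)
      then show "\<exists>M. \<forall>v. g v \<le> v \<bullet> a j + M" by blast
    qed
    show "convex {x. \<exists>M. \<forall>v. g v \<le> v \<bullet> x + M}"
    proof (rule convexI, clarify)
      fix x y M N and s t :: real
      assume st: "0 \<le> s" "0 \<le> t" "s + t = 1"
        and xy: "\<forall>v. g v \<le> v \<bullet> x + M" "\<forall>v. g v \<le> v \<bullet> y + N"
      have "g v \<le> v \<bullet> (s *\<^sub>R x + t *\<^sub>R y) + (s * M + t * N)" for v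
      proof -
        have "g v = s * g v + t * g v" using st by (simp add: distrib_right[symmetric])
        also have "\<dots> \<le> s * (v \<bullet> x + M) + t * (v \<bullet> y + N)"
          using st xy by (intro add_mono mult_left_mono) auto
        finally show ?thesis by (simp add: inner_add_right algebra_simps)
      qed
      then show "\<exists>K. \<forall>v. g v \<le> v \<bullet> (s *\<^sub>R x + t *\<^sub>R y) + K" by blast
    qed
  qed
  with y show ?thesis by blast
qed

section \<open>Weights from a potential\<close>

text \<open>An index used at \<open>v\<close> gets the constant term of its affine bound supporting
  \<open>g\<close> at \<open>v\<close>. Supergradients only locate \<open>a j\<close> in a hull;
  \<open>closed\<close> recovers the index even if points repeat or are not vertices.\<close>

lemma weight_exists:
  assumes fin: "\<And>u. finite (F u)"
    and closed: "\<And>u v j. j \<in> F v \<Longrightarrow> a j \<in> convex hull (a ` F u) \<Longrightarrow> j \<in> F u"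
    and hull: "\<And>j. j \<in> A \<Longrightarrow> a j \<in> convex hull (a ` (\<Union>u. F u))"
  shows "\<exists>\<omega> g. \<forall>u. \<forall>j\<in>A. g u \<le> u \<bullet> a j + \<omega> j \<and> (u \<bullet> a j + \<omega> j = g u \<longleftrightarrow> j \<in> F u)"
proof -
  obtain g where g: "potential_on UNIV g" using potential_on_UNIV by blast
  note sup = potential_supergradient[OF g]
  have "\<exists>\<omega>. \<forall>u. g u \<le> u \<bullet> a j + \<omega> \<and> (u \<bullet> a j + \<omega> = g u \<longleftrightarrow> j \<in> F u)" if j: "j \<in> A" for j
  proof (cases "\<exists>v. j \<in> F v")
    case True
    then obtain v where v: "j \<in> F v" by blast
    have "j \<in> F u" if eq: "u \<bullet> a j + (g v - v \<bullet> a j) = g u" for u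
    proof (rule closed[OF v], rule supergradient_in_hull[OF g fin])
      fix x show "g x \<le> g u + (x - u) \<bullet> a j"
        using sup[OF v, of x] eq by (simp add: inner_diff_left)
    qed
    \<comment> \<open>The supergradient inequalities from \<open>v\<close> to \<open>u\<close> and
      back give equality, so the weight does not depend on the choice of \<open>v\<close>.\<close>
    moreover have "u \<bullet> a j + (g v - v \<bullet> a j) = g u" if u: "j \<in> F u" for u
      using sup[OF v, of u] sup[OF u, of v] by (simp add: inner_diff_left)
    moreover have "g u \<le> u \<bullet> a j + (g v - v \<bullet> a j)" for u
      using sup[OF v, of u] by (simp add: inner_diff_left)
    ultimately show ?thesis by (intro exI[of _ "g v - v \<bullet> a j"]) blast
  next
    case False
    obtain M where "\<forall>v. g v \<le> v \<bullet> a j + M"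
      using potential_bounded_on_hull[OF g hull[OF j]] by blast
    \<comment> \<open>The extra 1 makes the bound strict, so an index in no cell is never a
      minimizer.\<close>
    then have "\<forall>v. g v < v \<bullet> a j + (M + 1)" by (metis add.assoc le_less_trans less_add_one)
    with False show ?thesis by (intro exI[of _ "M + 1"]) (auto simp: less_imp_le less_imp_neq[symmetric])
  qed
  then have "\<exists>\<omega>. \<forall>j\<in>A. \<forall>u. g u \<le> u \<bullet> a j + \<omega> j \<and> (u \<bullet> a j + \<omega> j = g u \<longleftrightarrow> j \<in> F u)"
    by (intro bchoice) blast
  then show ?thesis by blast
qed

end

section \<open>Coherent cells near a point and far out\<close>

lemma mem_coherent_cell_iff:
  assumes "finite A"
  shows "i \<in> coherent_cell a A w u \<longleftrightarrow> i \<in> A \<and> (\<forall>j\<in>A. u \<bullet> a i + w i \<le> u \<bullet> a j + w j)"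
proof (cases "i \<in> A")
  case True
  then have "u \<bullet> a i + w i = Min ((\<lambda>j. u \<bullet> a j + w j) ` A) \<longleftrightarrow>
      u \<bullet> a i + w i \<in> (\<lambda>j. u \<bullet> a j + w j) ` A \<and> (\<forall>y\<in>(\<lambda>j. u \<bullet> a j + w j) ` A. u \<bullet> a i + w i \<le> y)"
    using assms by (intro eq_Min_iff) auto
  with True show ?thesis unfolding coherent_cell_def by blast
qed (simp add: coherent_cell_def)

lemma coherent_cell_nonempty:
  assumes "finite A" "A \<noteq> {}"
  shows "coherent_cell a A w u \<noteq> {}"
proof -
  have "Min ((\<lambda>j. u \<bullet> a j + w j) ` A) \<in> (\<lambda>j. u \<bullet> a j + w j) ` A"
    using assms by (intro Min_in) auto
  then show ?thesis by (force simp: coherent_cell_def)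
qed

text \<open>The finitely many strict inequalities against indices outside the cell at
  \<open>u\<close> persist nearby. Minimality at \<open>v\<close> combined with minimality at
  \<open>u\<close> cancels the weights.\<close>

lemma coherent_cell_near:
  assumes A: "finite A" "A \<noteq> {}"
  shows "\<forall>\<^sub>F v in nhds u. \<forall>j\<in>coherent_cell a A w v. j \<in> coherent_cell a A w u \<and>
    (\<forall>i\<in>coherent_cell a A w u. (v - u) \<bullet> a j \<le> (v - u) \<bullet> a i)"
proof -
  let ?C = "coherent_cell a A w"
  obtain i where i: "i \<in> ?C u" using coherent_cell_nonempty[OF A] by blast
  have "\<forall>\<^sub>F v in nhds u. v \<bullet> a i + w i < v \<bullet> a j + w j" if j: "j \<in> A - ?C u" for j
  proof -
    have "u \<bullet> a i + w i < u \<bullet> a j + w j"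
      using i j A(1) by (fastforce simp: mem_coherent_cell_iff)
    then have "0 < u \<bullet> a j + w j - (u \<bullet> a i + w i)" by simp
    moreover have "((\<lambda>v. v \<bullet> a j + w j - (v \<bullet> a i + w i)) \<longlongrightarrow> u \<bullet> a j + w j - (u \<bullet> a i + w i)) (nhds u)"
      by (intro tendsto_intros filterlim_ident)
    ultimately have "\<forall>\<^sub>F v in nhds u. 0 < v \<bullet> a j + w j - (v \<bullet> a i + w i)"
      by (intro order_tendstoD(1))
    then show ?thesis by eventually_elim simp
  qed
  then have "\<forall>\<^sub>F v in nhds u. \<forall>j\<in>A - ?C u. v \<bullet> a i + w i < v \<bullet> a j + w j"
    using A(1) by (simp add: eventually_ball_finite_distrib)
  then show ?thesis
  proof eventually_elim
    case (elim v)
    show ?case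
    proof (intro ballI conjI)
      fix j assume j: "j \<in> ?C v"
      show ju: "j \<in> ?C u"
      proof -
        have "j \<in> A" "v \<bullet> a j + w j \<le> v \<bullet> a i + w i"
          using j i A(1) by (auto simp: mem_coherent_cell_iff)
        then show ?thesis using elim by (meson DiffI not_le)
      qed
      fix l assume l: "l \<in> ?C u"
      have "v \<bullet> a j + w j \<le> v \<bullet> a l + w l" "u \<bullet> a l + w l \<le> u \<bullet> a j + w j"
        using j ju l A(1) by (auto simp: mem_coherent_cell_iff)
      then show "(v - u) \<bullet> a j \<le> (v - u) \<bullet> a l" by (simp add: inner_diff_left)
    qed
  qed
qed

text \<open>At \<open>t *\<^sub>R v\<close> with \<open>t\<close> large, the linear term outweighs
  the finitely many weight differences.\<close>

lemma coherent_cell_far: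
  assumes A: "finite A"
  shows "\<exists>u. \<forall>j\<in>coherent_cell a A w u. \<forall>i\<in>A. v \<bullet> a j \<le> v \<bullet> a i"
proof -
  have "\<forall>\<^sub>F t in at_top. v \<bullet> a i < v \<bullet> a j \<longrightarrow> w i - w j < t * (v \<bullet> a j - v \<bullet> a i)" for i j
  proof (cases "v \<bullet> a i < v \<bullet> a j")
    case True
    have "\<forall>\<^sub>F t in at_top. (w i - w j) / (v \<bullet> a j - v \<bullet> a i) < t" by (rule eventually_gt_at_top)
    then show ?thesis by eventually_elim (use True in \<open>simp add: divide_less_eq\<close>)
  qed simp
  then have "\<forall>\<^sub>F t in at_top. \<forall>i\<in>A. \<forall>j\<in>A. v \<bullet> a i < v \<bullet> a j \<longrightarrow> w i - w j < t * (v \<bullet> a j - v \<bullet> a i)"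
    using A by (simp add: eventually_ball_finite_distrib)
  then obtain t where t: "\<And>i j. i \<in> A \<Longrightarrow> j \<in> A \<Longrightarrow> v \<bullet> a i < v \<bullet> a j \<Longrightarrow> w i - w j < t * (v \<bullet> a j - v \<bullet> a i)"
    unfolding eventually_at_top_linorder by blast
  have "v \<bullet> a j \<le> v \<bullet> a i" if j: "j \<in> coherent_cell a A w (t *\<^sub>R v)" and i: "i \<in> A" for i j
  proof (rule ccontr)
    assume "\<not> v \<bullet> a j \<le> v \<bullet> a i"
    then have "w i - w j < t * (v \<bullet> a j - v \<bullet> a i)"
      using t i j A by (simp add: mem_coherent_cell_iff)
    moreover have "t * (v \<bullet> a j) + w j \<le> t * (v \<bullet> a i) + w i"
      using i j A by (auto simp: mem_coherent_cell_iff)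
    ultimately show False by (simp add: right_diff_distrib)
  qed
  then show ?thesis by blast
qed

section \<open>Faces and hulls of the cells of a subdivision\<close>

text \<open>Faces of a polytope are exposed, by some \<open>c \<bullet> x \<le> b\<close>; since
  \<open>config_face\<close> minimizes, \<open>u\<close> is \<open>- c\<close>. It collects every
  index whose point is on the face, not only vertices.\<close>

lemma face_of_Conv_eq_config_face:
  assumes F: "finite F" and X: "X face_of Conv a F" "X \<noteq> {}"
  shows "\<exists>u. Conv a (config_face a F u) = X \<and> (\<forall>j\<in>F. a j \<in> X \<longrightarrow> j \<in> config_face a F u)"
proof -
  have "polyhedron (Conv a F)"
    using F by (simp add: Conv_def polytope_convex_hull polytope_imp_polyhedron)
  then have "X exposed_face_of Conv a F" using X(1) by (simp add: exposed_face_of_polyhedron)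
  then obtain c b where cb: "Conv a F \<subseteq> {x. c \<bullet> x \<le> b}" "X = Conv a F \<inter> {x. c \<bullet> x = b}"
    unfolding exposed_face_of_def by blast
  obtain S where S: "S \<subseteq> a ` F" "X = convex hull S"
    using face_of_convex_hull_subset[of "a ` F" X] F X(1)
    by (auto simp: Conv_def finite_imp_compact)
  have inF: "a j \<in> Conv a F" if "j \<in> F" for j
    using that by (simp add: Conv_def hull_inc)
  have "S \<noteq> {}" using S X(2) by auto
  then obtain i where i: "i \<in> F" "a i \<in> X" using S by (metis all_not_in_conv hull_inc image_iff subsetD)
  have "Min ((\<lambda>j. (- c) \<bullet> a j) ` F) = - b"
  proof (rule Min_eqI)
    show "- b \<in> (\<lambda>j. (- c) \<bullet> a j) ` F" using i cb(2) by (intro image_eqI[of _ _ i]) auto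
    show "- b \<le> y" if "y \<in> (\<lambda>j. (- c) \<bullet> a j) ` F" for y
      using that cb(1) inF by fastforce
  qed (use F in simp)
  then have face: "config_face a F (- c) = {j \<in> F. a j \<in> X}"
    using cb(2) inF unfolding config_face_def by auto
  have "Conv a (config_face a F (- c)) = X"
  proof
    show "Conv a (config_face a F (- c)) \<subseteq> X"
      unfolding Conv_def face using X(1) by (intro hull_minimal) (auto intro: face_of_imp_convex)
    have "S \<subseteq> a ` config_face a F (- c)"
      using S hull_subset[of S convex] unfolding face by blast
    then show "X \<subseteq> Conv a (config_face a F (- c))"
      unfolding Conv_def S(2) by (rule hull_mono)
  qed
  with face show ?thesis by blast
qed

text \<open>The common part of the two hulls is the hull of a face of \<open>F\<close> and of a face
  of \<open>G\<close>. Both faces are cells with the same hull, so they coincide, and the one in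
  \<open>G\<close> contains \<open>j\<close>.\<close>

lemma subdivision_cell_closed:
  assumes D: "subdivision a A D" and A: "finite A"
    and FG: "F \<in> D" "G \<in> D" and j: "j \<in> G" "a j \<in> Conv a F"
  shows "j \<in> F"
proof (cases "F = G")
  case False
  have fin: "finite F" "finite G"
    using D FG A unfolding subdivision_def by (meson PowD finite_subset subsetD)+
  have X: "(Conv a F \<inter> Conv a G) face_of Conv a F" "(Conv a F \<inter> Conv a G) face_of Conv a G"
    using D FG False unfolding subdivision_def by blast+
  have jX: "a j \<in> Conv a F \<inter> Conv a G" using j by (simp add: Conv_def hull_inc)
  obtain u where u: "Conv a (config_face a F u) = Conv a F \<inter> Conv a G"
    using face_of_Conv_eq_config_face[OF fin(1) X(1)] jX by blast
  obtain v where v: "Conv a (config_face a G v) = Conv a F \<inter> Conv a G" "j \<in> config_face a G v"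
    using face_of_Conv_eq_config_face[OF fin(2) X(2)] jX j(1) by blast
  have faces: "config_face a F u \<in> D" "config_face a G v \<in> D"
    using D FG by (auto simp: subdivision_def)
  \<comment> \<open>Distinct cells with equal hulls would meet in the whole of each, which the last
    clause of \<open>subdivision\<close> excludes.\<close>
  have "H = K" if "H \<in> D" "K \<in> D" "Conv a H = Conv a K" for H K
    using D that unfolding subdivision_def by (metis Int_absorb)
  from this[OF faces] have "config_face a F u = config_face a G v"
    using u v(1) by simp
  then show ?thesis using v(2) by (auto simp: config_face_def)
qed (use j in simp)

section \<open>Changing one coordinate of a Minkowski sum\<close>

lemma mink_sum_fun_upd:
  fixes f :: "nat \<Rightarrow> 'i \<Rightarrow> 'b::ab_group_add"
  assumes "i \<in> {1..k}"
  shows "mink_sum k f (J(i := x)) = mink_sum k f J - f i (J i) + f i x"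
proof -
  have "(\<Sum>l\<in>{1..k} - {i}. f l ((J(i := x)) l)) = (\<Sum>l\<in>{1..k} - {i}. f l (J l))"
    by (rule sum.cong) auto
  then show ?thesis
    unfolding mink_sum_def sum.remove[OF finite_atLeastAtMost assms] by simp
qed

lemma mink_index_mem: "J \<in> mink_index k G \<Longrightarrow> i \<in> {1..k} \<Longrightarrow> J i \<in> G i"
  unfolding mink_index_def by (rule PiE_mem)

lemma mink_index_fun_upd:
  assumes "J \<in> mink_index k G" "i \<in> {1..k}" "x \<in> G i"
  shows "J(i := x) \<in> mink_index k G"
  using assms by (auto simp: mink_index_def PiE_iff extensional_def)

section \<open>Weights on the factors of a mixed coherent subdivision\<close>

theorem theorem2p17:
  fixes k :: nat
    and A :: "nat \<Rightarrow> 'i set"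
    and a :: "nat \<Rightarrow> 'i \<Rightarrow> real ^ 'e::finite"
    and w :: "(nat \<Rightarrow> 'i) \<Rightarrow> real"
  assumes "\<And>i. i \<in> {1..k} \<Longrightarrow> point_configuration (a i) (A i)"
    and "\<And>i. i \<in> {1..k} \<Longrightarrow> aff_dim (Conv (a i) (A i)) = 1 \<Longrightarrow> card (A i) = 2"
    and "mixed_subdivision k a A (coherent_subdivision (mink_sum k a) (mink_index k A) w)"
  shows "\<exists>ws :: nat \<Rightarrow> 'i \<Rightarrow> real.
           coherent_subdivision (mink_sum k a) (mink_index k A) (mink_sum k ws) =
           coherent_subdivision (mink_sum k a) (mink_index k A) w"
proof (cases "mink_index k A = {}")
  case True
  then show ?thesis by (simp add: coherent_subdivision_def coherent_cell_def)
next
  case nonempty: False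
  let ?C = "coherent_cell (mink_sum k a) (mink_index k A) w"
  have finA: "finite (A i)" if "i \<in> {1..k}" for i
    using assms(1)[OF that] by (simp add: point_configuration_def)
  then have fin: "finite (mink_index k A)"
    unfolding mink_index_def by (intro finite_PiE) auto
  obtain D where D: "\<And>i. i \<in> {1..k} \<Longrightarrow> subdivision (a i) (A i) (D i)"
    and "\<forall>F\<in>coherent_subdivision (mink_sum k a) (mink_index k A) w.
          \<exists>G. (\<forall>i\<in>{1..k}. G i \<in> D i) \<and> F = mink_index k G"
    using assms(3) unfolding mixed_subdivision_def by blast
  then have "\<forall>u. \<exists>G. (\<forall>i\<in>{1..k}. G i \<in> D i) \<and> ?C u = mink_index k G"
    unfolding coherent_subdivision_def by blast
  then obtain G where GD: "\<And>u i. i \<in> {1..k} \<Longrightarrow> G u i \<in> D i" and G: "\<And>u. ?C u = mink_index k (G u)"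
    by metis
  have Csub: "?C u \<subseteq> mink_index k A" for u by (auto simp: coherent_cell_def)
  \<comment> \<open>Since the cell is a nonempty product, one coordinate of any of its tuples can be
    replaced freely.\<close>
  have lift: "\<exists>J\<in>?C u. J i = j" if "i \<in> {1..k}" "j \<in> G u i" for u i j
  proof -
    obtain J where "J \<in> ?C u" using coherent_cell_nonempty[OF fin nonempty] by blast
    then have "J(i := j) \<in> ?C u" using that by (simp add: G mink_index_fun_upd)
    then show ?thesis by (intro bexI[of _ "J(i := j)"]) simp_all
  qed
  have Gin: "J i \<in> G u i" if "J \<in> ?C u" "i \<in> {1..k}" for u i J
    using that unfolding G by (rule mink_index_mem)
  have GA: "G u i \<subseteq> A i" if i: "i \<in> {1..k}" for u i
    using D[OF i] GD[OF i, of u] by (auto simp: subdivision_def)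
  have "\<exists>\<omega> g. \<forall>u. \<forall>j\<in>A i. g u \<le> u \<bullet> a i j + \<omega> j \<and> (u \<bullet> a i j + \<omega> j = g u \<longleftrightarrow> j \<in> G u i)"
    if i: "i \<in> {1..k}" for i
  proof -
    interpret cell_field "a i" "\<lambda>u. G u i"
    proof
      show "G u i \<noteq> {}" for u
        using coherent_cell_nonempty[OF fin nonempty, of "mink_sum k a" w u] Gin[OF _ i, of _ u] by blast
      show "\<forall>\<^sub>F v in nhds u. \<forall>j\<in>G v i. j \<in> G u i \<and> (\<forall>l\<in>G u i. (v - u) \<bullet> a i j \<le> (v - u) \<bullet> a i l)" for u
        using coherent_cell_near[OF fin nonempty, where u = u and a = "mink_sum k a" and w = w]
      proof eventually_elim
        case (elim v)
        show ?case
        proof (intro ballI conjI)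
          fix j assume "j \<in> G v i"
          then obtain J where J: "J \<in> ?C v" "J i = j" using lift i by blast
          then have Ju: "J \<in> ?C u" using elim by blast
          then show "j \<in> G u i" using Gin i J(2) by blast
          fix l assume "l \<in> G u i"
          \<comment> \<open>The exchanged tuple stays in the product cell, and comparing it with
            \<open>J\<close> leaves only the summands at \<open>i\<close>.\<close>
          then have "J(i := l) \<in> ?C u" using Ju i by (simp add: G mink_index_fun_upd)
          then have "(v - u) \<bullet> mink_sum k a J \<le> (v - u) \<bullet> mink_sum k a (J(i := l))"
            using elim J(1) by blast
          then show "(v - u) \<bullet> a i j \<le> (v - u) \<bullet> a i l"
            using J(2) by (simp add: mink_sum_fun_upd[OF i] inner_add_right inner_diff_right)
        qed
      qed
    qed
    \<comment> \<open>Otherwise some \<open>v\<close> separates \<open>a i j\<close> from all points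
      used. In a cell far out along \<open>v\<close>, replacing \<open>J i\<close> by
      \<open>j\<close> would lower the value of \<open>v\<close> below its minimum on the
      sum.\<close>
    have "a i j \<in> convex hull (a i ` (\<Union>u. G u i))" if j: "j \<in> A i" for j
    proof (rule ccontr)
      assume "a i j \<notin> convex hull (a i ` (\<Union>u. G u i))"
      moreover have "finite (\<Union>u. G u i)"
        using GA[OF i] finA[OF i] by (meson UN_least finite_subset)
      then have "closed (convex hull (a i ` (\<Union>u. G u i)))"
        by (simp add: compact_convex_hull compact_imp_closed finite_imp_compact)
      ultimately obtain v b where vb: "v \<bullet> a i j < b"
          "\<And>x. x \<in> convex hull (a i ` (\<Union>u. G u i)) \<Longrightarrow> b < v \<bullet> x"
        using separating_hyperplane_closed_point[OF convex_convex_hull] by metis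
      obtain u where u: "\<And>J K. J \<in> ?C u \<Longrightarrow> K \<in> mink_index k A \<Longrightarrow> v \<bullet> mink_sum k a J \<le> v \<bullet> mink_sum k a K"
        using coherent_cell_far[OF fin] by blast
      obtain J where J: "J \<in> ?C u" using coherent_cell_nonempty[OF fin nonempty] by blast
      then have "J(i := j) \<in> mink_index k A" using subsetD[OF Csub J] i j by (simp add: mink_index_fun_upd)
      from u[OF J this] have "v \<bullet> a i (J i) \<le> v \<bullet> a i j"
        by (simp add: mink_sum_fun_upd[OF i] inner_add_right inner_diff_right)
      moreover have "b < v \<bullet> a i (J i)" using Gin[OF J i] by (intro vb(2) hull_inc) blast
      ultimately show False using vb(1) by linarith
    qed
    moreover have "finite (G u i)" for u using GA[OF i] finA[OF i] finite_subset by blast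
    \<comment> \<open>Here the mixed structure enters a second time: \<open>G u i\<close> and
      \<open>G v i\<close> are cells of one subdivision \<open>D i\<close>.\<close>
    moreover have "j \<in> G u i" if "j \<in> G v i" "a i j \<in> convex hull (a i ` G u i)" for u v j
      using subdivision_cell_closed[OF D[OF i] finA[OF i] GD[OF i] GD[OF i] that(1)] that(2)
      by (simp add: Conv_def)
    ultimately show ?thesis by (intro weight_exists) auto
  qed
  then obtain ws g where ws: "\<And>i u j. i \<in> {1..k} \<Longrightarrow> j \<in> A i \<Longrightarrow> g i u \<le> u \<bullet> a i j + ws i j"
    "\<And>i u j. i \<in> {1..k} \<Longrightarrow> j \<in> A i \<Longrightarrow> u \<bullet> a i j + ws i j = g i u \<longleftrightarrow> j \<in> G u i"
    by metis
  have "coherent_cell (mink_sum k a) (mink_index k A) (mink_sum k ws) u = ?C u" for u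
  proof -
    let ?val = "\<lambda>J. u \<bullet> mink_sum k a J + mink_sum k ws J"
    have val: "?val J = (\<Sum>i=1..k. u \<bullet> a i (J i) + ws i (J i))" for J
      by (simp add: mink_sum_def inner_sum_right sum.distrib)
    have JA: "J i \<in> A i" if "J \<in> mink_index k A" "i \<in> {1..k}" for J i
      using that by (rule mink_index_mem)
    have ge: "(\<Sum>i=1..k. g i u) \<le> ?val J" if "J \<in> mink_index k A" for J
      unfolding val using that by (intro sum_mono ws(1) JA)
    \<comment> \<open>Termwise bounds with equal sums force equality in each term, so the tuples
      attaining the bound form the product of the \<open>G u i\<close>.\<close>
    have eq: "?val J = (\<Sum>i=1..k. g i u) \<longleftrightarrow> J \<in> ?C u" if J: "J \<in> mink_index k A" for J
    proof
      assume "?val J = (\<Sum>i=1..k. g i u)"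
      then have sums: "(\<Sum>i=1..k. g i u) = (\<Sum>i=1..k. u \<bullet> a i (J i) + ws i (J i))"
        by (simp add: val)
      have "J i \<in> G u i" if i: "i \<in> {1..k}" for i
      proof -
        have "g i u = u \<bullet> a i (J i) + ws i (J i)"
          using sums ws(1)[OF _ JA[OF J]] i finite_atLeastAtMost by (rule sum_mono_inv)
        then show ?thesis using ws(2)[OF i JA[OF J i], of u] by simp
      qed
      then have "J \<in> mink_index k (G u)" using J by (auto simp: mink_index_def PiE_iff)
      then show "J \<in> ?C u" by (simp add: G)
    next
      assume "J \<in> ?C u"
      then show "?val J = (\<Sum>i=1..k. g i u)"
        unfolding val by (intro sum.cong refl) (use ws(2)[OF _ JA[OF J]] Gin in blast)
    qed
    \<comment> \<open>The tuple \<open>K\<close> attains the lower bound, which is therefore the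
      minimum defining the new cell.\<close>
    obtain K where K: "K \<in> ?C u" using coherent_cell_nonempty[OF fin nonempty] by blast
    then have "?val K = (\<Sum>i=1..k. g i u)" and "K \<in> mink_index k A"
      using eq subsetD[OF Csub] by blast+
    with ge have "J \<in> coherent_cell (mink_sum k a) (mink_index k A) (mink_sum k ws) u \<longleftrightarrow>
        J \<in> mink_index k A \<and> ?val J = (\<Sum>i=1..k. g i u)" for J
      unfolding mem_coherent_cell_iff[OF fin] by (metis order_antisym)
    then show ?thesis using eq subsetD[OF Csub] by blast
  qed
  then have "coherent_subdivision (mink_sum k a) (mink_index k A) (mink_sum k ws) =
      coherent_subdivision (mink_sum k a) (mink_index k A) w"
    by (simp add: coherent_subdivision_def)
  then show ?thesis by blast
qed

end
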